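(* Let $d\ge 1$. For any $\sigma\geq 0$, the map $\mathsf{W}_1^{(\sigma)}:\mathcal{P}_1(\mathbb{R}^d)\times\mathcal{P}_1(\mathbb{R}^d)\to[0,+\infty)$ is a metric on $\mathcal{P}_1(\mathbb{R}^d)$.
   Context: $\mathcal{P}(\mathbb{R}^d)$ is the set of Borel probability measures on $\mathbb{R}^d$, and $\mathcal{P}_1(\mathbb{R}^d)\subset\mathcal{P}(\mathbb{R}^d)$ consists of those with finite first moment, $\int\|x\|\,d\mu(x)<\infty$, where $\|\cdot\|$ is the Euclidean norm. $\Pi(\mu,\nu)$ is the set of couplings of $\mu$ and $\nu$, i.e. probability measures on $\mathbb{R}^d\times\mathbb{R}^d$ with first marginal $\mu$ and second marginal $\nu$. The 1-Wasserstein distance is $\mathsf{W}_1(\mu,\nu)=\inf_{\pi\in\Pi(\mu,\nu)}\int\|x-y\|\,d\pi(x,y)$. For $\sigma\ge0$, $\mathcal{N}_\sigma=\mathcal{N}(0,\sigma^2 \mathrm{I}_d)$ is the isotropic Gaussian measure on $\mathbb{R}^d$ (with $\mathcal{N}_0=\delta_0$, the Dirac measure at $0$), and $\ast$ denotes convolution of measures. The Gaussian-smoothed 1-Wasserstein distance is $\mathsf{W}_1^{(\sigma)}(\mu,\nu)=\mathsf{W}_1(\mu\ast\mathcal{N}_\sigma,\nu\ast\mathcal{N}_\sigma)$; in particular $\mathsf{W}_1^{(0)}=\mathsf{W}_1$. *)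

theory Defs
  imports "HOL-Probability.Probability"
begin

definition borel_probs :: "'a::topological_space measure set" where
  "borel_probs = {\<mu>. prob_space \<mu> \<and> sets \<mu> = sets borel}"

definition P1 :: "'a::euclidean_space measure set" where
  "P1 = {\<mu> \<in> borel_probs. (\<integral>\<^sup>+ x. ennreal (norm x) \<partial>\<mu>) < \<infinity>}"

(* borel :: ('a * 'a) measure coincides with the product of the two borel measure spaces
   (borel_prod), since 'a is second countable. *)
definition couplings ::
    "'a::euclidean_space measure \<Rightarrow> 'a measure \<Rightarrow> ('a \<times> 'a) measure set" where
  "couplings \<mu> \<nu> = {\<pi> \<in> borel_probs. distr \<pi> borel fst = \<mu> \<and> distr \<pi> borel snd = \<nu>}"

(* Values are extended reals, so that finiteness is a genuine claim. *)
definition W1 :: "'a::euclidean_space measure \<Rightarrow> 'a measure \<Rightarrow> ennreal" where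
  "W1 \<mu> \<nu> = (INF \<pi>\<in>couplings \<mu> \<nu>. \<integral>\<^sup>+ z. ennreal (norm (fst z - snd z)) \<partial>\<pi>)"

definition gaussian :: "real \<Rightarrow> 'a::euclidean_space measure" where
  "gaussian \<sigma> =
     (if \<sigma> = 0 then return borel 0
      else density lborel
        (\<lambda>x. ennreal (exp (- (norm x)\<^sup>2 / (2 * \<sigma>\<^sup>2)) / sqrt (2 * pi * \<sigma>\<^sup>2) ^ DIM('a))))"

(* The order on 'a is irrelevant here: it is only the sort required by the library's convolution. *)
definition W1_smooth ::
    "real \<Rightarrow> 'a::ordered_euclidean_space measure \<Rightarrow> 'a measure \<Rightarrow> ennreal" where
  "W1_smooth \<sigma> \<mu> \<nu> = W1 (convolution \<mu> (gaussian \<sigma>)) (convolution \<nu> (gaussian \<sigma>))"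

end

theory Submission imports Defs begin

text \<open>
  Write \<open>\<mu>\<^sub>\<sigma>\<close> for the convolution of \<open>\<mu>\<close> with \<open>gaussian \<sigma>\<close>. Smoothing maps \<open>P1\<close> to itself, since Gaussians have a
  finite first moment. The smoothed distance is therefore the pullback of \<open>W1\<close> along the map \<open>\<mu> \<mapsto> \<mu>\<^sub>\<sigma>\<close> of \<open>P1\<close>, and it is
  a metric as soon as \<open>W1\<close> is a metric on \<open>P1\<close> and that map is injective.

  For \<open>W1\<close>, finiteness comes from the product coupling and symmetry from swapping coordinates. The
  triangle inequality needs two couplings with a common marginal to be glued. Instead of disintegrating
  them, the common marginal is cut into countably many cells of diameter below \<open>e\<close>, and the couplings are made
  conditionally independent given the cell (\<open>gluing_along_nat_valued_maps\<close>). This has an explicit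
  density and loses only an error \<open>e\<close>, which is harmless since \<open>W1\<close> is an infimum (\<open>W1_triangle\<close>). If
  \<open>W1 \<mu> \<nu> = 0\<close>, Markov's inequality compares \<open>\<mu>\<close> on a closed set with \<open>\<nu>\<close> on its thickenings, and the two
  measures agree on closed sets, hence everywhere (\<open>W1_eq_0_imp_eq\<close>).

  For injectivity, the characteristic function of \<open>\<mu>\<^sub>\<sigma>\<close> is that of \<open>\<mu>\<close> times a Gaussian without zeros, so \<open>\<mu>\<^sub>\<sigma>\<close>
  determines the characteristic function of \<open>\<mu>\<close>. It remains to see that a characteristic function
  determines its measure (\<open>char_fun_eq_imp_eq\<close>). Since a Gaussian kernel is a Fourier
  transform of a Gaussian, the density of \<open>\<mu>\<^sub>s\<close> is an integral of the characteristic function of \<open>\<mu>\<close>, for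
  every \<open>s > 0\<close>. As \<open>W1 \<mu> \<mu>\<^sub>s\<close> is at most the first moment of \<open>gaussian s\<close>, which is of order \<open>s\<close>, letting \<open>s\<close> tend
  to \<open>0\<close> shows that two measures with the same characteristic function have \<open>W1\<close>-distance zero, and the
  separation property of \<open>W1\<close> already established applies.
\<close>

section \<open>Couplings and transport cost\<close>

text \<open>
  The joint law of two random variables is a coupling of their laws. All upper bounds on \<open>W1\<close> below
  come from a choice of \<open>X\<close> and \<open>Y\<close> on a common probability space.
\<close>
lemma W1_distr_le:
  fixes X Y :: "'b \<Rightarrow> 'a::euclidean_space"
  assumes "prob_space M" and [measurable]: "X \<in> borel_measurable M" "Y \<in> borel_measurable M"
  shows "W1 (distr M borel X) (distr M borel Y) \<le> (\<integral>\<^sup>+ \<omega>. ennreal (norm (X \<omega> - Y \<omega>)) \<partial>M)"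
proof -
  interpret prob_space M by fact
  let ?\<pi> = "distr M borel (\<lambda>\<omega>. (X \<omega>, Y \<omega>))"
  have "?\<pi> \<in> couplings (distr M borel X) (distr M borel Y)"
    by (simp add: couplings_def borel_probs_def distr_distr comp_def prob_space_distr
        borel_prod[symmetric])
  moreover have "(\<integral>\<^sup>+ z. ennreal (norm (fst z - snd z)) \<partial>?\<pi>)
      = (\<integral>\<^sup>+ \<omega>. ennreal (norm (X \<omega> - Y \<omega>)) \<partial>M)"
    by (subst nn_integral_distr) (auto simp: borel_prod[symmetric])
  ultimately show ?thesis
    unfolding W1_def by (metis (no_types, lifting) INF_lower)
qed

lemma couplingsD:
  assumes "\<pi> \<in> couplings \<mu> \<nu>"
  shows "prob_space \<pi>" "sets \<pi> = sets borel"
    "distr \<pi> borel fst = \<mu>" "distr \<pi> borel snd = \<nu>"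
    "fst \<in> borel_measurable \<pi>" "snd \<in> borel_measurable \<pi>"
proof -
  show s: "prob_space \<pi>" "sets \<pi> = sets borel"
    "distr \<pi> borel fst = \<mu>" "distr \<pi> borel snd = \<nu>"
    using assms by (auto simp: couplings_def borel_probs_def)
  show "fst \<in> borel_measurable \<pi>" "snd \<in> borel_measurable \<pi>"
    by (simp_all add: measurable_cong_sets[OF s(2) refl] borel_prod[symmetric])
qed

lemma borel_probsD:
  assumes "\<mu> \<in> borel_probs"
  shows "prob_space \<mu>" "sets \<mu> = sets borel"
  using assms by (auto simp: borel_probs_def)

text \<open>
  On a coupling of \<open>\<nu>\<close> and \<open>\<mu>\<close>, take the two projections in the opposite order. The
  locale of metric spaces asks for symmetry on the whole type, hence for arbitrary measures.
\<close>
lemma W1_commute_le: "W1 \<mu> \<nu> \<le> W1 \<nu> \<mu>"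
  unfolding W1_def[of \<nu>]
proof (rule INF_greatest)
  fix \<pi> assume "\<pi> \<in> couplings \<nu> \<mu>"
  note \<pi> = couplingsD[OF this]
  show "W1 \<mu> \<nu> \<le> (\<integral>\<^sup>+ z. ennreal (norm (fst z - snd z)) \<partial>\<pi>)"
    using W1_distr_le[OF \<pi>(1) \<pi>(6) \<pi>(5)] by (simp add: \<pi>(3,4) norm_minus_commute)
qed

lemma W1_commute: "W1 \<mu> \<nu> = W1 \<nu> \<mu>"
  by (intro antisym W1_commute_le)

lemma W1_self:
  assumes "\<mu> \<in> borel_probs"
  shows "W1 \<mu> \<mu> = 0"
proof -
  note \<mu> = borel_probsD[OF assms]
  have "(\<lambda>x. x) \<in> borel_measurable \<mu>" by (simp add: measurable_cong_sets[OF \<mu>(2) refl])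
  moreover have "distr \<mu> borel (\<lambda>x. x) = \<mu>" using \<mu>(2) by (intro distr_id2) simp
  ultimately show ?thesis
    using W1_distr_le[OF \<mu>(1), of "\<lambda>x. x" "\<lambda>x. x"] by simp
qed

lemma distr_fst_pair_measure:
  assumes "sets \<mu> = sets borel" "prob_space \<nu>"
  shows "distr (\<mu> \<Otimes>\<^sub>M \<nu>) borel fst = \<mu>"
proof -
  have "distr (\<mu> \<Otimes>\<^sub>M \<nu>) borel fst = distr (\<mu> \<Otimes>\<^sub>M \<nu>) \<mu> fst"
    by (rule distr_cong) (simp_all add: assms(1))
  then show ?thesis using prob_space.distr_pair_fst[OF assms(2)] by simp
qed

lemma distr_snd_pair_measure:
  assumes "sets \<nu> = sets borel" "prob_space \<mu>" "prob_space \<nu>"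
  shows "distr (\<mu> \<Otimes>\<^sub>M \<nu>) borel snd = \<nu>"
proof (rule measure_eqI)
  interpret \<mu>: prob_space \<mu> by fact
  interpret \<nu>: prob_space \<nu> by fact
  note [measurable_cong] = assms(1)
  fix A assume "A \<in> sets (distr (\<mu> \<Otimes>\<^sub>M \<nu>) borel snd)"
  then have A: "A \<in> sets borel" by simp
  have "emeasure (distr (\<mu> \<Otimes>\<^sub>M \<nu>) borel snd) A = emeasure (\<mu> \<Otimes>\<^sub>M \<nu>) (space \<mu> \<times> A)"
    using A assms(1) sets_eq_imp_space_eq[OF assms(1)]
    by (subst emeasure_distr) (auto simp: space_pair_measure intro!: arg_cong[where f="emeasure _"])
  also have "\<dots> = emeasure \<nu> A"
    using A assms(1) by (simp add: \<nu>.emeasure_pair_measure_Times \<mu>.emeasure_space_1)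
  finally show "emeasure (distr (\<mu> \<Otimes>\<^sub>M \<nu>) borel snd) A = emeasure \<nu> A" .
qed (simp add: assms(1))

lemma W1_finite:
  assumes "\<mu> \<in> P1" "\<nu> \<in> P1"
  shows "W1 \<mu> \<nu> < \<infinity>"
proof -
  have \<mu>: "prob_space \<mu>" "sets \<mu> = sets borel" "(\<integral>\<^sup>+ x. ennreal (norm x) \<partial>\<mu>) < \<infinity>"
   and \<nu>: "prob_space \<nu>" "sets \<nu> = sets borel" "(\<integral>\<^sup>+ x. ennreal (norm x) \<partial>\<nu>) < \<infinity>"
    using assms by (auto simp: P1_def borel_probs_def)
  note [measurable_cong] = \<mu>(2) \<nu>(2)
  interpret \<mu>: prob_space \<mu> by fact
  interpret \<nu>: prob_space \<nu> by fact
  interpret pair_prob_space \<mu> \<nu> ..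
  have fst: "distr (\<mu> \<Otimes>\<^sub>M \<nu>) borel fst = \<mu>"
    by (rule distr_fst_pair_measure) fact+
  have snd: "distr (\<mu> \<Otimes>\<^sub>M \<nu>) borel snd = \<nu>"
    by (rule distr_snd_pair_measure) fact+
  have "W1 \<mu> \<nu> \<le> (\<integral>\<^sup>+ z. ennreal (norm (fst z - snd z)) \<partial>(\<mu> \<Otimes>\<^sub>M \<nu>))"
    using W1_distr_le[OF prob_space_axioms, of fst snd] by (simp add: fst snd)
  also have "\<dots> \<le> (\<integral>\<^sup>+ z. ennreal (norm (fst z)) + ennreal (norm (snd z)) \<partial>(\<mu> \<Otimes>\<^sub>M \<nu>))"
    by (intro nn_integral_mono) (auto simp: ennreal_plus[symmetric] norm_triangle_ineq4 simp del: ennreal_plus)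
  also have "\<dots> = (\<integral>\<^sup>+ z. ennreal (norm (fst z)) \<partial>(\<mu> \<Otimes>\<^sub>M \<nu>)) + (\<integral>\<^sup>+ z. ennreal (norm (snd z)) \<partial>(\<mu> \<Otimes>\<^sub>M \<nu>))"
    by (intro nn_integral_add) auto
  also have "\<dots> = (\<integral>\<^sup>+ x. ennreal (norm x) \<partial>distr (\<mu> \<Otimes>\<^sub>M \<nu>) borel fst)
      + (\<integral>\<^sup>+ x. ennreal (norm x) \<partial>distr (\<mu> \<Otimes>\<^sub>M \<nu>) borel snd)"
    by (subst (1 2) nn_integral_distr) auto
  also have "\<dots> < \<infinity>" using \<mu>(3) \<nu>(3) by (simp add: fst snd)
  finally show ?thesis .
qed

section \<open>Gluing and the triangle inequality\<close>

lemma emeasure_level_set_eq: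
  assumes [measurable]: "X \<in> measurable P (count_space UNIV)" "Y \<in> measurable Q (count_space UNIV)"
    and law: "distr P (count_space UNIV) X = distr Q (count_space UNIV) Y"
  shows "emeasure P {p\<in>space P. X p = k} = emeasure Q {q\<in>space Q. Y q = k}"
proof -
  have "emeasure P {p\<in>space P. X p = k} = emeasure (distr P (count_space UNIV) X) {k}"
    by (auto simp: emeasure_distr intro!: arg_cong[where f="emeasure P"])
  also have "\<dots> = emeasure Q {q\<in>space Q. Y q = k}"
    unfolding law by (auto simp: emeasure_distr intro!: arg_cong[where f="emeasure Q"])
  finally show ?thesis .
qed

text \<open>
  The function \<open>(p, q) \<mapsto> [X p = Y q] / P(X = X p)\<close> is a probability density in \<open>q\<close> for almost every \<open>p\<close>:
  the level set of \<open>Y\<close> through \<open>q\<close> has the same mass as the matching level set of \<open>X\<close>, and only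
  countably many level sets exist, so those of mass zero together form a null set.
\<close>
lemma nn_integral_matching_weight:
  fixes X :: "'b \<Rightarrow> nat" and Y :: "'c \<Rightarrow> nat"
  assumes "prob_space P" "prob_space Q"
    and X[measurable]: "X \<in> measurable P (count_space UNIV)"
    and Y[measurable]: "Y \<in> measurable Q (count_space UNIV)"
    and law: "distr P (count_space UNIV) X = distr Q (count_space UNIV) Y"
    and h[measurable]: "h \<in> borel_measurable P"
  shows "(\<integral>\<^sup>+ p. \<integral>\<^sup>+ q. h p * (if X p = Y q then inverse (emeasure P {p'\<in>space P. X p' = X p}) else 0) \<partial>Q \<partial>P)
    = (\<integral>\<^sup>+ p. h p \<partial>P)"
proof -
  interpret P: prob_space P by fact
  interpret Q: prob_space Q by fact
  define a where "a k = emeasure P {p\<in>space P. X p = k}" for k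
  have aQ: "emeasure Q {q\<in>space Q. Y q = k} = a k" for k
    unfolding a_def by (rule emeasure_level_set_eq[OF X Y law, symmetric])
  have "AE p in P. \<forall>k. a k = 0 \<longrightarrow> X p \<noteq> k"
    unfolding AE_all_countable
  proof
    fix k show "AE p in P. a k = 0 \<longrightarrow> X p \<noteq> k"
      by (cases "a k = 0") (auto simp: a_def AE_iff_measurable[OF _ refl])
  qed
  then have pos: "AE p in P. a (X p) \<noteq> 0" by auto
  have "(\<integral>\<^sup>+ q. h p * (if X p = Y q then inverse (a (X p)) else 0) \<partial>Q) = h p"
    if "a (X p) \<noteq> 0" for p
  proof -
    have "(\<integral>\<^sup>+ q. h p * (if X p = Y q then inverse (a (X p)) else 0) \<partial>Q)
      = (\<integral>\<^sup>+ q. (h p * inverse (a (X p))) * indicator {q\<in>space Q. Y q = X p} q \<partial>Q)"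
      by (intro nn_integral_cong) (auto simp: indicator_def)
    also have "\<dots> = h p * (inverse (a (X p)) * a (X p))"
      by (subst nn_integral_cmult_indicator) (auto simp: aQ mult.assoc)
    also have "inverse (a (X p)) * a (X p) = 1"
      using that ennreal_divide_self[of "a (X p)"]
      by (simp add: a_def divide_ennreal_def less_top[symmetric] mult.commute)
    finally show ?thesis by simp
  qed
  then show ?thesis
    unfolding a_def[symmetric] using pos by (intro nn_integral_cong_AE) auto
qed

text \<open>
  Gluing two probability spaces along countably many cells. Conditionally on the common cell, the two
  coordinates are made independent, so the glued measure has an explicit density with respect to the product and
  no disintegration is involved.
\<close>
lemma gluing_along_nat_valued_maps:
  fixes X :: "'b \<Rightarrow> nat" and Y :: "'c \<Rightarrow> nat"
  assumes "prob_space P" "prob_space Q"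
    and X[measurable]: "X \<in> measurable P (count_space UNIV)"
    and Y[measurable]: "Y \<in> measurable Q (count_space UNIV)"
    and law: "distr P (count_space UNIV) X = distr Q (count_space UNIV) Y"
  obtains \<Gamma> where "prob_space \<Gamma>" "sets \<Gamma> = sets (P \<Otimes>\<^sub>M Q)"
    "distr \<Gamma> P fst = P" "distr \<Gamma> Q snd = Q" "AE z in \<Gamma>. X (fst z) = Y (snd z)"
proof -
  interpret P: prob_space P by fact
  interpret Q: prob_space Q by fact
  interpret PQ: pair_prob_space P Q ..
  define a where "a k = emeasure P {p\<in>space P. X p = k}" for k
  define w where "w z = (if X (fst z) = Y (snd z) then inverse (a (X (fst z))) else 0)" for z
  have [measurable]: "w \<in> borel_measurable (P \<Otimes>\<^sub>M Q)" 
  proof -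
    \<comment> \<open>Splitting over the countably many common values reduces the matching event to measurable rectangles.\<close>
    have "Measurable.pred (P \<Otimes>\<^sub>M Q) (\<lambda>z. \<exists>k. X (fst z) = k \<and> Y (snd z) = k)"
      by measurable
    then have [measurable]: "Measurable.pred (P \<Otimes>\<^sub>M Q) (\<lambda>z. X (fst z) = Y (snd z))"
      by (simp add: eq_commute)
    have [measurable]: "(\<lambda>z. inverse (a (X (fst z)))) \<in> borel_measurable (P \<Otimes>\<^sub>M Q)"
      by (rule measurable_compose[of "\<lambda>z. X (fst z)" _ "count_space UNIV" "\<lambda>k. inverse (a k)"]) auto
    show ?thesis unfolding w_def by measurable
  qed
  have aQ: "a k = emeasure Q {q\<in>space Q. Y q = k}" for k
    unfolding a_def by (rule emeasure_level_set_eq[OF X Y law])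
  define \<Gamma> where "\<Gamma> = density (P \<Otimes>\<^sub>M Q) w"
  have [measurable_cong]: "sets \<Gamma> = sets (P \<Otimes>\<^sub>M Q)" by (simp add: \<Gamma>_def)
  have fst: "distr \<Gamma> P fst = P"
  proof (rule measure_eqI)
    fix A assume "A \<in> sets (distr \<Gamma> P fst)"
    then have [measurable]: "A \<in> sets P" by simp
    have "emeasure (distr \<Gamma> P fst) A = (\<integral>\<^sup>+ p. indicator A p \<partial>distr \<Gamma> P fst)" by simp
    also have "\<dots> = (\<integral>\<^sup>+ z. w z * indicator A (fst z) \<partial>(P \<Otimes>\<^sub>M Q))"
      by (simp add: nn_integral_distr \<Gamma>_def nn_integral_density del: nn_integral_indicator)
    also have "\<dots> = (\<integral>\<^sup>+ p. \<integral>\<^sup>+ q. indicator A p * (if X p = Y q then inverse (a (X p)) else 0) \<partial>Q \<partial>P)"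
      by (subst Q.nn_integral_fst[symmetric]) (measurable, auto simp: w_def mult.commute intro!: nn_integral_cong)
    also have "\<dots> = emeasure P A"
      unfolding a_def by (subst nn_integral_matching_weight[OF assms]) auto
    finally show "emeasure (distr \<Gamma> P fst) A = emeasure P A" .
  qed simp
  have snd: "distr \<Gamma> Q snd = Q"
  proof (rule measure_eqI)
    fix A assume "A \<in> sets (distr \<Gamma> Q snd)"
    then have [measurable]: "A \<in> sets Q" by simp
    have "emeasure (distr \<Gamma> Q snd) A = (\<integral>\<^sup>+ p. indicator A p \<partial>distr \<Gamma> Q snd)" by simp
    also have "\<dots> = (\<integral>\<^sup>+ z. w z * indicator A (snd z) \<partial>(P \<Otimes>\<^sub>M Q))"
      by (simp add: nn_integral_distr \<Gamma>_def nn_integral_density del: nn_integral_indicator)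
    \<comment> \<open>On matching pairs the weight is also \<open>1 / Q(Y = Y q)\<close>, so the second marginal is the first one
      with the roles of \<open>P\<close> and \<open>Q\<close> exchanged.\<close>
    also have "\<dots> = (\<integral>\<^sup>+ q. \<integral>\<^sup>+ p. indicator A q * (if Y q = X p then inverse (a (Y q)) else 0) \<partial>P \<partial>Q)"
      by (subst PQ.nn_integral_snd[symmetric]) (measurable, auto simp: w_def mult.commute intro!: nn_integral_cong)
    also have "\<dots> = emeasure Q A"
      unfolding aQ by (subst nn_integral_matching_weight[OF assms(2,1) Y X law[symmetric]]) auto
    finally show "emeasure (distr \<Gamma> Q snd) A = emeasure Q A" .
  qed simp
  have "prob_space (distr \<Gamma> P fst)" by (simp add: fst P.prob_space_axioms)
  then have "prob_space \<Gamma>" by (rule prob_space_distrD[rotated]) simp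
  moreover have "AE z in \<Gamma>. X (fst z) = Y (snd z)"
    unfolding \<Gamma>_def by (subst AE_density) (auto simp: w_def)
  ultimately show ?thesis using that fst snd \<open>sets \<Gamma> = _\<close> by blast
qed

text \<open>
  A countable partition into cells of diameter below \<open>e\<close>: a point belongs to the cell of the first
  member of a dense sequence that lies within \<open>e / 2\<close> of it.
\<close>
lemma small_cells:
  fixes e :: real
  assumes "e > 0"
  obtains N :: "'a::euclidean_space \<Rightarrow> nat"
  where "N \<in> measurable borel (count_space UNIV)" "\<And>x y. N x = N y \<Longrightarrow> norm (x - y) < e"
proof -
  obtain D :: "'a set" where D: "countable D" "\<And>X. open X \<Longrightarrow> X \<noteq> {} \<Longrightarrow> \<exists>d\<in>D. d \<in> X"
    using countable_dense_exists by metis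
  have "D \<noteq> {}" using D(2)[of UNIV] by auto
  define c where "c = from_nat_into D"
  define N where "N x = (LEAST n. dist x (c n) < e / 2)" for x
  have "\<exists>n. dist x (c n) < e / 2" for x
  proof -
    obtain d where "d \<in> D" "d \<in> ball x (e/2)" using D(2)[of "ball x (e/2)"] assms by auto
    moreover obtain n where "d = c n" unfolding c_def
      using from_nat_into_surj[OF D(1) \<open>d \<in> D\<close>] by metis
    ultimately show ?thesis by auto
  qed
  then have N: "dist x (c (N x)) < e / 2" for x unfolding N_def by (metis LeastI_ex)
  show ?thesis
  proof
    show "N \<in> measurable borel (count_space UNIV)" unfolding N_def by measurable
    fix x y assume "N x = N y"
    then show "norm (x - y) < e"
      using N[of x] N[of y] by (metis dist_norm dist_triangle_half_l)
  qed
qed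

text \<open>
  Glue \<open>\<pi>\<close> and \<open>\<pi>'\<close> along small cells of their common marginal \<open>\<nu>\<close>. The two copies of the middle point
  then need not agree, but lie in the same cell, which costs at most \<open>e\<close>.
\<close>
lemma W1_le_add_couplings:
  fixes \<mu> \<nu> \<rho> :: "'a::euclidean_space measure"
  assumes "\<pi> \<in> couplings \<mu> \<nu>" "\<pi>' \<in> couplings \<nu> \<rho>" "e > 0"
  shows "W1 \<mu> \<rho> \<le> (\<integral>\<^sup>+ z. ennreal (norm (fst z - snd z)) \<partial>\<pi>)
    + (\<integral>\<^sup>+ z. ennreal (norm (fst z - snd z)) \<partial>\<pi>') + ennreal e"
proof -
  note \<pi> = couplingsD[OF assms(1)] and \<pi>' = couplingsD[OF assms(2)]
  note [measurable] = \<pi>(5,6) \<pi>'(5,6)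
  obtain N :: "'a \<Rightarrow> nat" where N[measurable]: "N \<in> measurable borel (count_space UNIV)"
    and cell: "\<And>x y. N x = N y \<Longrightarrow> norm (x - y) < e"
    using small_cells[OF \<open>e > 0\<close>] by metis
  have "distr \<pi> (count_space UNIV) (N \<circ> snd) = distr \<nu> (count_space UNIV) N"
    by (subst \<pi>(4)[symmetric], subst distr_distr) auto
  moreover have "distr \<pi>' (count_space UNIV) (N \<circ> fst) = distr \<nu> (count_space UNIV) N"
    by (subst \<pi>'(3)[symmetric], subst distr_distr) auto
  ultimately have law: "distr \<pi> (count_space UNIV) (N \<circ> snd) = distr \<pi>' (count_space UNIV) (N \<circ> fst)"
    by simp
  obtain \<Gamma> where \<Gamma>: "prob_space \<Gamma>" "sets \<Gamma> = sets (\<pi> \<Otimes>\<^sub>M \<pi>')"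
    "distr \<Gamma> \<pi> fst = \<pi>" "distr \<Gamma> \<pi>' snd = \<pi>'"
    "AE z in \<Gamma>. (N \<circ> snd) (fst z) = (N \<circ> fst) (snd z)"
    by (rule gluing_along_nat_valued_maps[OF \<pi>(1) \<pi>'(1) _ _ law]) auto
  note [measurable_cong] = \<Gamma>(2)
  interpret \<Gamma>: prob_space \<Gamma> by fact
  have mu: "distr \<Gamma> borel (\<lambda>z. fst (fst z)) = \<mu>"
    using distr_distr[of fst \<pi> borel fst \<Gamma>] by (simp add: \<Gamma>(3) \<pi>(3) comp_def)
  have rho: "distr \<Gamma> borel (\<lambda>z. snd (snd z)) = \<rho>"
    using distr_distr[of snd \<pi>' borel snd \<Gamma>] by (simp add: \<Gamma>(4) \<pi>'(4) comp_def)
  have "W1 \<mu> \<rho> \<le> (\<integral>\<^sup>+ z. ennreal (norm (fst (fst z) - snd (snd z))) \<partial>\<Gamma>)"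
    using W1_distr_le[OF \<Gamma>(1), of "\<lambda>z. fst (fst z)" "\<lambda>z. snd (snd z)"] by (simp add: mu rho)
  also have "\<dots> \<le> (\<integral>\<^sup>+ z. ennreal (norm (fst (fst z) - snd (fst z)))
      + ennreal (norm (fst (snd z) - snd (snd z))) + ennreal e \<partial>\<Gamma>)"
  proof (rule nn_integral_mono_AE)
    show "AE z in \<Gamma>. ennreal (norm (fst (fst z) - snd (snd z))) \<le> ennreal (norm (fst (fst z) - snd (fst z)))
      + ennreal (norm (fst (snd z) - snd (snd z))) + ennreal e"
      using \<Gamma>(5)
    proof eventually_elim
      case (elim z)
      then have "norm (snd (fst z) - fst (snd z)) < e" using cell by simp
      then have "norm (fst (fst z) - snd (snd z))
        \<le> norm (fst (fst z) - snd (fst z)) + norm (fst (snd z) - snd (snd z)) + e"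
        using norm_triangle_ineq[of "fst (fst z) - snd (fst z)" "snd (fst z) - snd (snd z)"]
          norm_triangle_ineq[of "snd (fst z) - fst (snd z)" "fst (snd z) - snd (snd z)"] by simp
      then show ?case using \<open>e > 0\<close> by (simp add: ennreal_plus[symmetric] del: ennreal_plus)
    qed
  qed
  also have "\<dots> = (\<integral>\<^sup>+ z. ennreal (norm (fst (fst z) - snd (fst z))) \<partial>\<Gamma>)
      + (\<integral>\<^sup>+ z. ennreal (norm (fst (snd z) - snd (snd z))) \<partial>\<Gamma>) + ennreal e"
    by (simp add: nn_integral_add \<Gamma>.emeasure_space_1)
  also have "(\<integral>\<^sup>+ z. ennreal (norm (fst (fst z) - snd (fst z))) \<partial>\<Gamma>)
      = (\<integral>\<^sup>+ z. ennreal (norm (fst z - snd z)) \<partial>\<pi>)"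
    using nn_integral_distr[of fst \<Gamma> \<pi> "\<lambda>z. ennreal (norm (fst z - snd z))"] by (simp add: \<Gamma>(3))
  also have "(\<integral>\<^sup>+ z. ennreal (norm (fst (snd z) - snd (snd z))) \<partial>\<Gamma>)
      = (\<integral>\<^sup>+ z. ennreal (norm (fst z - snd z)) \<partial>\<pi>')"
    using nn_integral_distr[of snd \<Gamma> \<pi>' "\<lambda>z. ennreal (norm (fst z - snd z))"] by (simp add: \<Gamma>(4))
  finally show ?thesis .
qed

lemma W1_coupling_obtain:
  assumes "W1 \<mu> \<nu> < \<infinity>" "e > 0"
  obtains \<pi> where "\<pi> \<in> couplings \<mu> \<nu>"
    "(\<integral>\<^sup>+ z. ennreal (norm (fst z - snd z)) \<partial>\<pi>) \<le> W1 \<mu> \<nu> + ennreal e"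
proof -
  have "W1 \<mu> \<nu> < W1 \<mu> \<nu> + ennreal e"
    using assms ennreal_add_left_cancel_less[of "W1 \<mu> \<nu>" 0 "ennreal e"] by simp
  then obtain \<pi> where "\<pi> \<in> couplings \<mu> \<nu>"
    "(\<integral>\<^sup>+ z. ennreal (norm (fst z - snd z)) \<partial>\<pi>) < W1 \<mu> \<nu> + ennreal e"
    unfolding W1_def INF_less_iff by blast
  then show ?thesis using that less_imp_le by blast
qed

lemma W1_triangle: "W1 \<mu> \<rho> \<le> W1 \<mu> \<nu> + W1 \<nu> \<rho>"
proof (rule ennreal_le_epsilon)
  fix e :: real assume fin: "W1 \<mu> \<nu> + W1 \<nu> \<rho> < top" and "e > 0"
  then have e: "e / 3 > 0" by simp
  obtain \<pi> where \<pi>: "\<pi> \<in> couplings \<mu> \<nu>"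
    "(\<integral>\<^sup>+ z. ennreal (norm (fst z - snd z)) \<partial>\<pi>) \<le> W1 \<mu> \<nu> + ennreal (e/3)"
    using W1_coupling_obtain[OF _ e, of \<mu> \<nu>] fin by auto
  obtain \<pi>' where \<pi>': "\<pi>' \<in> couplings \<nu> \<rho>"
    "(\<integral>\<^sup>+ z. ennreal (norm (fst z - snd z)) \<partial>\<pi>') \<le> W1 \<nu> \<rho> + ennreal (e/3)"
    using W1_coupling_obtain[OF _ e, of \<nu> \<rho>] fin by auto
  have "W1 \<mu> \<rho> \<le> (W1 \<mu> \<nu> + ennreal (e/3)) + (W1 \<nu> \<rho> + ennreal (e/3)) + ennreal (e/3)"
    by (rule order_trans[OF W1_le_add_couplings[OF \<pi>(1) \<pi>'(1) e]])
      (intro add_mono \<pi>(2) \<pi>'(2) order_refl)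
  also have "\<dots> = W1 \<mu> \<nu> + W1 \<nu> \<rho> + (ennreal (e/3) + ennreal (e/3) + ennreal (e/3))"
    by (simp only: ac_simps)
  also have "ennreal (e/3) + ennreal (e/3) + ennreal (e/3) = ennreal e"
    using e by (simp add: ennreal_plus[symmetric] del: ennreal_plus)
  finally show "W1 \<mu> \<rho> \<le> W1 \<mu> \<nu> + W1 \<nu> \<rho> + ennreal e" .
qed

section \<open>Separation of measures\<close>

text \<open>
  Under the coupling, mass that starts in \<open>F\<close> either ends within \<open>\<delta>\<close> of \<open>F\<close> or travels at least \<open>\<delta>\<close>;
  Markov's inequality bounds the latter part.
\<close>
lemma emeasure_le_thickening:
  fixes \<mu> \<nu> :: "'a::euclidean_space measure"
  assumes "\<pi> \<in> couplings \<mu> \<nu>" "closed F" "\<delta> > 0"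
  shows "emeasure \<mu> F \<le> emeasure \<nu> {y. infdist y F \<le> \<delta>}
    + (\<integral>\<^sup>+ z. ennreal (norm (fst z - snd z)) \<partial>\<pi>) / ennreal \<delta>"
proof -
  note \<pi> = couplingsD[OF assms(1)]
  note [measurable] = \<pi>(5,6)
  have [measurable]: "F \<in> sets borel" using assms(2) by simp
  have sp: "space \<pi> = UNIV" using sets_eq_imp_space_eq[OF \<pi>(2)] by simp
  let ?T = "{y. infdist y F \<le> \<delta>}"
  let ?far = "{z \<in> space \<pi>. 1 \<le> inverse (ennreal \<delta>) * ennreal (norm (fst z - snd z))}"
  have "closed ?T" by (intro closed_Collect_le continuous_intros)
  then have T[measurable]: "?T \<in> sets borel" by simp
  have far: "1 \<le> inverse (ennreal \<delta>) * ennreal r" if "\<delta> \<le> r" for r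
  proof -
    have "inverse (ennreal \<delta>) * ennreal r = ennreal (inverse \<delta> * r)"
      using assms(3) that by (simp add: inverse_ennreal ennreal_mult)
    moreover have "1 \<le> inverse \<delta> * r" using assms(3) that by (simp add: field_simps)
    ultimately show ?thesis by (simp add: ennreal_ge_1)
  qed
  have "emeasure \<mu> F = emeasure \<pi> (fst -` F \<inter> space \<pi>)"
    by (subst \<pi>(3)[symmetric], subst emeasure_distr) auto
  also have "\<dots> \<le> emeasure \<pi> ((snd -` ?T \<inter> space \<pi>) \<union> ?far)"
  proof (rule emeasure_mono)
    show "fst -` F \<inter> space \<pi> \<subseteq> (snd -` ?T \<inter> space \<pi>) \<union> ?far"
    proof
      fix z assume "z \<in> fst -` F \<inter> space \<pi>"
      then have "infdist (snd z) F \<le> norm (fst z - snd z)"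
        by (metis IntD1 dist_commute dist_norm infdist_le vimageE)
      then show "z \<in> (snd -` ?T \<inter> space \<pi>) \<union> ?far"
        using far[of "norm (fst z - snd z)"] by (cases "infdist (snd z) F \<le> \<delta>") (auto simp: sp)
    qed
  qed measurable
  also have "\<dots> \<le> emeasure \<pi> (snd -` ?T \<inter> space \<pi>) + emeasure \<pi> ?far"
    by (intro emeasure_subadditive) measurable
  also have "emeasure \<pi> (snd -` ?T \<inter> space \<pi>) = emeasure \<nu> ?T"
    by (subst \<pi>(4)[symmetric], subst emeasure_distr) auto
  also have "emeasure \<pi> ?far \<le> inverse (ennreal \<delta>) *
      (\<integral>\<^sup>+ z. ennreal (norm (fst z - snd z)) * indicator (space \<pi>) z \<partial>\<pi>)"
    using nn_integral_Markov_inequality[of "\<lambda>z. ennreal (norm (fst z - snd z))" "space \<pi>" \<pi> "inverse (ennreal \<delta>)"]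
    by simp
  also have "\<dots> = (\<integral>\<^sup>+ z. ennreal (norm (fst z - snd z)) \<partial>\<pi>) / ennreal \<delta>"
    by (simp add: divide_ennreal_def mult.commute sp)
  finally show ?thesis by (simp add: add_left_mono)
qed

text \<open>
  Couplings of arbitrarily small cost give \<open>\<mu> F \<le> \<nu> F'\<close> for every closed thickening \<open>F'\<close> of \<open>F\<close>, and the
  thickenings decrease to \<open>F\<close>.
\<close>
lemma W1_eq_0_imp_closed_le:
  fixes \<mu> \<nu> :: "'a::euclidean_space measure"
  assumes "prob_space \<nu>" "sets \<nu> = sets borel" "W1 \<mu> \<nu> = 0" "closed F"
  shows "emeasure \<mu> F \<le> emeasure \<nu> F"
  \<comment> \<open>The distance to the empty set is \<open>0\<close> everywhere, so the thickenings of \<open>{}\<close> do not shrink to it.\<close>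
proof (cases "F = {}")
  case False
  interpret \<nu>: prob_space \<nu> by fact
  define T where "T n = {y. infdist y F \<le> inverse (real (Suc n))}" for n
  have T: "emeasure \<mu> F \<le> emeasure \<nu> (T n)" for n
  proof (rule ennreal_le_epsilon)
    fix e :: real assume "e > 0"
    define \<delta> where "\<delta> = inverse (real (Suc n))"
    have \<delta>: "\<delta> > 0" by (simp add: \<delta>_def)
    \<comment> \<open>Cost \<open>\<delta> * e\<close> makes the Markov term at most \<open>e\<close>.\<close>
    obtain \<pi> where \<pi>: "\<pi> \<in> couplings \<mu> \<nu>"
      "(\<integral>\<^sup>+ z. ennreal (norm (fst z - snd z)) \<partial>\<pi>) \<le> W1 \<mu> \<nu> + ennreal (\<delta> * e)"
      using W1_coupling_obtain[of \<mu> \<nu> "\<delta> * e"] \<delta> \<open>e > 0\<close> assms(3) by auto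
    have "emeasure \<mu> F \<le> emeasure \<nu> {y. infdist y F \<le> \<delta>}
      + (\<integral>\<^sup>+ z. ennreal (norm (fst z - snd z)) \<partial>\<pi>) / ennreal \<delta>"
      by (rule emeasure_le_thickening[OF \<pi>(1) assms(4) \<delta>])
    also have "\<dots> \<le> emeasure \<nu> {y. infdist y F \<le> \<delta>} + ennreal (\<delta> * e) / ennreal \<delta>"
      using \<pi>(2) assms(3) by (intro add_mono divide_right_mono_ennreal) auto
    also have "ennreal (\<delta> * e) / ennreal \<delta> = ennreal e"
      using \<delta> \<open>e > 0\<close> by (simp add: divide_ennreal)
    finally show "emeasure \<mu> F \<le> emeasure \<nu> (T n) + ennreal e"
      by (simp add: T_def \<delta>_def)
  qed
  have "closed (T n)" for n
    unfolding T_def by (intro closed_Collect_le continuous_intros)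
  then have meas: "T n \<in> sets \<nu>" for n by (simp add: assms(2))
  have "decseq T"
  proof (rule decseq_SucI)
    fix n show "T (Suc n) \<subseteq> T n"
    proof
      fix y assume "y \<in> T (Suc n)"
      then have "infdist y F \<le> inverse (real (Suc (Suc n)))" by (simp add: T_def)
      also have "\<dots> \<le> inverse (real (Suc n))" by (rule le_imp_inverse_le) auto
      finally show "y \<in> T n" by (simp add: T_def)
    qed
  qed
  have "(\<Inter>n. T n) = F"
  proof
    show "F \<subseteq> (\<Inter>n. T n)" by (auto simp: T_def)
    show "(\<Inter>n. T n) \<subseteq> F"
    proof
      fix y assume "y \<in> (\<Inter>n. T n)"
      then have "infdist y F \<le> inverse (real (Suc n))" for n by (auto simp: T_def)
      then have "infdist y F \<le> 0" using LIMSEQ_inverse_real_of_nat by (intro LIMSEQ_le_const) auto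
      then have "infdist y F = 0" using infdist_nonneg[of y F] by linarith
      then show "y \<in> F" using in_closed_iff_infdist_zero[OF assms(4) False] by blast
    qed
  qed
  then have "emeasure \<nu> F = (INF n. emeasure \<nu> (T n))"
    using INF_emeasure_decseq'[OF meas \<open>decseq T\<close>] by simp
  then show ?thesis using T by (simp add: INF_greatest)
qed simp

lemma W1_eq_0_imp_eq:
  fixes \<mu> \<nu> :: "'a::euclidean_space measure"
  assumes "\<mu> \<in> borel_probs" "\<nu> \<in> borel_probs" "W1 \<mu> \<nu> = 0"
  shows "\<mu> = \<nu>"
proof (rule measure_eqI_generator_eq[where E="Collect closed" and \<Omega>=UNIV and A="\<lambda>_. UNIV"])
  note \<mu> = borel_probsD[OF assms(1)] and \<nu> = borel_probsD[OF assms(2)]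
  interpret \<mu>: prob_space \<mu> by fact
  show "Int_stable (Collect closed :: 'a set set)" by (auto simp: Int_stable_def)
  show "emeasure \<mu> F = emeasure \<nu> F" if "F \<in> Collect closed" for F
    using that assms(3) W1_commute[of \<mu> \<nu>]
    by (intro antisym W1_eq_0_imp_closed_le \<mu> \<nu>) auto
  show "sets \<mu> = sigma_sets UNIV (Collect closed)" "sets \<nu> = sigma_sets UNIV (Collect closed)"
    by (simp_all add: \<mu> \<nu> borel_eq_closed)
qed (use prob_space.emeasure_le_1[OF borel_probsD(1)[OF assms(1)]] in
      \<open>auto simp: top_unique neq_top_trans[OF ennreal_one_neq_top]\<close>)

section \<open>Gaussian measures\<close>

lemma sets_gaussian [simp, measurable_cong]: "sets (gaussian \<sigma>) = sets borel"
  by (simp add: gaussian_def)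

lemma prod_normal_density:
  fixes x :: "'a::euclidean_space"
  assumes "\<sigma> > 0"
  shows "(\<Prod>b\<in>Basis. normal_density 0 \<sigma> (x \<bullet> b))
    = exp (- (norm x)\<^sup>2 / (2 * \<sigma>\<^sup>2)) / sqrt (2 * pi * \<sigma>\<^sup>2) ^ DIM('a)"
proof -
  have "(norm x)\<^sup>2 = (\<Sum>b\<in>Basis. (x \<bullet> b)\<^sup>2)"
    unfolding power2_norm_eq_inner euclidean_inner[of x x] by (simp add: power2_eq_square)
  then have "(\<Sum>b\<in>Basis. - (x \<bullet> b)\<^sup>2 / (2 * \<sigma>\<^sup>2)) = - (norm x)\<^sup>2 / (2 * \<sigma>\<^sup>2)"
    by (simp add: sum_divide_distrib sum_negf)
  then show ?thesis
    by (simp add: normal_density_def prod.distrib prod_dividef exp_sum[symmetric] power_one_over)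
qed

lemma gaussian_eq_prod_density:
  assumes "\<sigma> > 0"
  shows "gaussian \<sigma> = density (lborel :: 'a::euclidean_space measure)
    (\<lambda>x. \<Prod>b\<in>Basis. ennreal (normal_density 0 \<sigma> (x \<bullet> b)))"
  using assms unfolding gaussian_def by (simp add: prod_ennreal prod_normal_density)

lemma nn_integral_normal_density:
  assumes "\<sigma> > 0"
  shows "(\<integral>\<^sup>+ x. ennreal (normal_density 0 \<sigma> x) \<partial>lborel) = 1"
  using prob_space.emeasure_space_1[OF prob_space_normal_density[OF assms, of 0]]
  by (simp add: emeasure_density)

lemma prob_space_gaussian:
  assumes "\<sigma> \<ge> 0"
  shows "prob_space (gaussian \<sigma>)"
proof (cases "\<sigma> = 0")
  case False
  then have "\<sigma> > 0" using assms by simp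
  then show ?thesis
    by (intro prob_spaceI)
      (simp add: gaussian_eq_prod_density emeasure_density nn_integral_normal_density
        nn_integral_lborel_prod[of "\<lambda>_ x. ennreal (normal_density 0 \<sigma> x)"])
qed (simp add: gaussian_def prob_space_return)

text \<open>
  The Euclidean norm is at most the sum of the absolute coordinates, each of which is a centred normal
  variable with mean absolute value \<open>\<sigma> * sqrt (2 / pi)\<close>. The linear decay
  as \<open>\<sigma>\<close> tends to \<open>0\<close> makes small smoothings negligible in \<open>W1\<close>.
\<close>
lemma nn_integral_norm_gaussian_le:
  assumes "\<sigma> \<ge> 0"
  shows "(\<integral>\<^sup>+ x. ennreal (norm x) \<partial>(gaussian \<sigma> :: 'a::euclidean_space measure))
    \<le> ennreal (DIM('a) * sqrt (2 / pi) * \<sigma>)"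
proof (cases "\<sigma> = 0")
  case True
  then show ?thesis by (simp add: gaussian_def nn_integral_return)
next
  case False
  then have \<sigma>: "\<sigma> > 0" using assms by simp
  let ?g = "\<lambda>x. ennreal (normal_density 0 \<sigma> x)"
  have one_dim: "(\<integral>\<^sup>+ x. ?g x * ennreal \<bar>x\<bar> \<partial>lborel) = ennreal (\<sigma> * sqrt (2 / pi))"
    using normal_moment_abs_odd[OF \<sigma>, of 0 0]
    by (simp add: ennreal_mult'[symmetric] nn_integral_eq_integral has_bochner_integral_iff)
  have coord: "(\<integral>\<^sup>+ x. ennreal \<bar>x \<bullet> c\<bar> \<partial>(gaussian \<sigma> :: 'a measure)) = ennreal (\<sigma> * sqrt (2 / pi))"
    if c: "c \<in> Basis" for c :: 'a
  proof -
    \<comment> \<open>The factor \<open>\<bar>x \<bullet> c\<bar>\<close> is absorbed into coordinate \<open>c\<close>, so that the integrand stays a product over coordinates.\<close>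
    let ?h = "\<lambda>b x. ?g x * (if b = c then ennreal \<bar>x\<bar> else 1)"
    have "(\<integral>\<^sup>+ x. ennreal \<bar>x \<bullet> c\<bar> \<partial>(gaussian \<sigma> :: 'a measure))
      = (\<integral>\<^sup>+ x. (\<Prod>b\<in>Basis. ?g (x \<bullet> b)) * ennreal \<bar>x \<bullet> c\<bar> \<partial>lborel)"
      by (simp add: gaussian_eq_prod_density[OF \<sigma>] nn_integral_density)
    also have "\<dots> = (\<integral>\<^sup>+ x. (\<Prod>b\<in>Basis. ?h b (x \<bullet> b)) \<partial>(lborel :: 'a measure))"
      using c by (intro nn_integral_cong) (simp add: prod.distrib prod.delta)
    also have "\<dots> = (\<Prod>b\<in>Basis. (\<integral>\<^sup>+ x. ?h b x \<partial>lborel))"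
      by (rule nn_integral_lborel_prod) auto
    also have "\<dots> = (\<Prod>b\<in>(Basis::'a set). if b = c then ennreal (\<sigma> * sqrt (2 / pi)) else 1)"
      by (intro prod.cong refl) (auto simp: one_dim nn_integral_normal_density[OF \<sigma>])
    also have "\<dots> = ennreal (\<sigma> * sqrt (2 / pi))" using c by (simp add: prod.delta)
    finally show ?thesis .
  qed
  have "(\<integral>\<^sup>+ x. ennreal (norm x) \<partial>(gaussian \<sigma> :: 'a measure))
    \<le> (\<integral>\<^sup>+ x. (\<Sum>b\<in>Basis. ennreal \<bar>x \<bullet> b\<bar>) \<partial>(gaussian \<sigma> :: 'a measure))"
    by (intro nn_integral_mono) (simp add: norm_le_l1 ennreal_leI)
  also have "\<dots> = (\<Sum>b\<in>Basis. (\<integral>\<^sup>+ x. ennreal \<bar>x \<bullet> b\<bar> \<partial>(gaussian \<sigma> :: 'a measure)))"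
    by (rule nn_integral_sum) simp
  also have "\<dots> = (\<Sum>b\<in>(Basis::'a set). ennreal (\<sigma> * sqrt (2 / pi)))"
    by (intro sum.cong refl coord)
  also have "\<dots> = ennreal (DIM('a) * sqrt (2 / pi) * \<sigma>)"
    using \<sigma> by (simp add: ennreal_of_nat_eq_real_of_nat ennreal_mult'[symmetric] ac_simps)
  finally show ?thesis .
qed

section \<open>Characteristic functions\<close>

lemma borel_measurable_cis [measurable]: "cis \<in> borel_measurable borel"
  by (intro borel_measurable_continuous_onI continuous_intros)

definition char_fun :: "'a::euclidean_space measure \<Rightarrow> 'a \<Rightarrow> complex" where
  "char_fun \<mu> t = (\<integral>x. cis (t \<bullet> x) \<partial>\<mu>)"

text \<open>
  Rescaling by \<open>\<sigma>\<close> reduces to the characteristic function of the standard normal distribution.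
\<close>
lemma integral_normal_density_cis:
  assumes "\<sigma> > 0"
  shows "(\<integral>x. normal_density 0 \<sigma> x *\<^sub>R cis (u * x) \<partial>lborel) = complex_of_real (exp (- (\<sigma> * u)\<^sup>2 / 2))"
proof -
  have "(\<integral>x. normal_density 0 \<sigma> x *\<^sub>R cis (u * x) \<partial>lborel)
    = \<sigma> *\<^sub>R (\<integral>x. normal_density 0 \<sigma> (\<sigma> * x) *\<^sub>R cis (u * (\<sigma> * x)) \<partial>lborel)"
    using assms lborel_integral_real_affine[of \<sigma> "\<lambda>x. normal_density 0 \<sigma> x *\<^sub>R cis (u * x)" 0] by simp
  also have "\<dots> = (\<integral>x. \<sigma> *\<^sub>R (normal_density 0 \<sigma> (\<sigma> * x) *\<^sub>R cis (u * (\<sigma> * x))) \<partial>lborel)"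
    by (rule integral_scaleR_right[symmetric])
  also have "\<dots> = (\<integral>x. std_normal_density x *\<^sub>R iexp ((\<sigma> * u) * x) \<partial>lborel)"
  proof (intro Bochner_Integration.integral_cong refl)
    fix x :: real
    have "\<sigma> * normal_density 0 \<sigma> (\<sigma> * x) = std_normal_density x"
      using assms by (simp add: normal_density_def real_sqrt_mult power_mult_distrib)
    then show "\<sigma> *\<^sub>R (normal_density 0 \<sigma> (\<sigma> * x) *\<^sub>R cis (u * (\<sigma> * x)))
        = std_normal_density x *\<^sub>R iexp ((\<sigma> * u) * x)"
      by (simp add: cis_conv_exp ac_simps scaleR_scaleR)
  qed
  also have "\<dots> = char std_normal_distribution (\<sigma> * u)"
    unfolding char_def by (subst integral_density) auto
  finally show ?thesis by (simp add: char_std_normal_distribution)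
qed

lemma integral_lborel_prod:
  fixes f :: "'a::euclidean_space \<Rightarrow> real \<Rightarrow> complex"
  assumes f: "\<And>b. b \<in> Basis \<Longrightarrow> integrable lborel (f b)"
  shows "(\<integral>x. (\<Prod>b\<in>Basis. f b (x \<bullet> b)) \<partial>lborel) = (\<Prod>b\<in>Basis. \<integral>x. f b x \<partial>lborel)"
proof -
  interpret product_sigma_finite "\<lambda>_::'a. lborel :: real measure" ..
  have [measurable]: "f b \<in> borel_measurable borel" if "b \<in> Basis" for b
    using f[OF that] by auto
  have "(\<integral>x. (\<Prod>b\<in>Basis. f b (x \<bullet> b)) \<partial>lborel)
    = (\<integral>y. (\<Prod>b\<in>Basis. f b ((\<Sum>c\<in>Basis. y c *\<^sub>R c) \<bullet> b)) \<partial>(\<Pi>\<^sub>M b\<in>(Basis::'a set). lborel))"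
    by (subst lborel_eq, subst integral_distr) auto
  also have "\<dots> = (\<integral>y. (\<Prod>b\<in>Basis. f b (y b)) \<partial>(\<Pi>\<^sub>M b\<in>(Basis::'a set). lborel))"
    by (intro Bochner_Integration.integral_cong refl prod.cong) simp
  also have "\<dots> = (\<Prod>b\<in>Basis. \<integral>x. f b x \<partial>lborel)"
    by (rule product_integral_prod) (auto intro: f)
  finally show ?thesis .
qed

text \<open>
  Both the density and the character \<open>cis (t \<bullet> x)\<close> factor over the coordinates. Two consequences are used later:
  the characteristic function has no zeros, and a Gaussian kernel is itself a characteristic function.
\<close>
lemma char_fun_gaussian:
  fixes t :: "'a::euclidean_space"
  assumes "\<sigma> \<ge> 0"
  shows "char_fun (gaussian \<sigma>) t = complex_of_real (exp (- \<sigma>\<^sup>2 * (norm t)\<^sup>2 / 2))"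
proof (cases "\<sigma> = 0")
  case True
  then show ?thesis unfolding char_fun_def gaussian_def by (simp, subst integral_return) auto
next
  case False
  then have \<sigma>: "\<sigma> > 0" using assms by simp
  have cis: "cis (t \<bullet> x) = (\<Prod>b\<in>Basis. cis ((t \<bullet> b) * (x \<bullet> b)))" for x
    unfolding cis_conv_exp euclidean_inner[of t x]
    by (simp add: exp_sum[symmetric] sum_distrib_left)
  have "char_fun (gaussian \<sigma>) t
    = (\<integral>x. (\<Prod>b\<in>Basis. normal_density 0 \<sigma> (x \<bullet> b)) *\<^sub>R cis (t \<bullet> x) \<partial>lborel)"
    unfolding char_fun_def gaussian_eq_prod_density[OF \<sigma>]
    by (simp add: prod_ennreal, subst integral_density) (auto intro!: prod_nonneg)
  also have "\<dots> = (\<integral>x. (\<Prod>b\<in>Basis. normal_density 0 \<sigma> (x \<bullet> b) *\<^sub>R cis ((t \<bullet> b) * (x \<bullet> b))) \<partial>lborel)"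
    by (simp add: cis scaleR_conv_of_real prod.distrib)
  also have "\<dots> = (\<Prod>b\<in>Basis. \<integral>x. normal_density 0 \<sigma> x *\<^sub>R cis ((t \<bullet> b) * x) \<partial>lborel)"
  proof (rule integral_lborel_prod[of "\<lambda>b x. normal_density 0 \<sigma> x *\<^sub>R cis ((t \<bullet> b) * x)"])
    fix b :: 'a
    show "integrable lborel (\<lambda>x. normal_density 0 \<sigma> x *\<^sub>R cis ((t \<bullet> b) * x))"
      by (rule Bochner_Integration.integrable_bound[OF integrable_normal_density[OF \<sigma>, of 0]]) auto
  qed
  also have "\<dots> = (\<Prod>b\<in>Basis. complex_of_real (exp (- (\<sigma> * (t \<bullet> b))\<^sup>2 / 2)))"
    by (simp add: integral_normal_density_cis[OF \<sigma>])
  also have "\<dots> = complex_of_real (exp (\<Sum>b\<in>Basis. - (\<sigma> * (t \<bullet> b))\<^sup>2 / 2))"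
    by (simp add: exp_sum)
  also have "(\<Sum>b\<in>Basis. - (\<sigma> * (t \<bullet> b))\<^sup>2 / 2) = - \<sigma>\<^sup>2 * (norm t)\<^sup>2 / 2"
    unfolding power2_norm_eq_inner euclidean_inner[of t t]
    by (simp add: sum_distrib_left sum_negf
        sum_divide_distrib power2_eq_square ac_simps)
  finally show ?thesis .
qed

lemma char_fun_convolution:
  fixes \<mu> \<nu> :: "'a::ordered_euclidean_space measure"
  assumes "\<mu> \<in> borel_probs" "\<nu> \<in> borel_probs"
  shows "char_fun (convolution \<mu> \<nu>) t = char_fun \<mu> t * char_fun \<nu> t"
proof -
  note \<mu> = borel_probsD[OF assms(1)] and \<nu> = borel_probsD[OF assms(2)]
  note [measurable_cong] = \<mu>(2) \<nu>(2)
  interpret \<mu>: prob_space \<mu> by fact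
  interpret \<nu>: prob_space \<nu> by fact
  interpret pair_prob_space \<mu> \<nu> ..
  have "char_fun (convolution \<mu> \<nu>) t = (\<integral>z. cis (t \<bullet> (fst z + snd z)) \<partial>(\<mu> \<Otimes>\<^sub>M \<nu>))"
    unfolding char_fun_def convolution_def
    by (subst integral_distr) (auto simp: case_prod_beta)
  also have "\<dots> = (\<integral>x. \<integral>y. cis (t \<bullet> x) * cis (t \<bullet> y) \<partial>\<nu> \<partial>\<mu>)"
    by (subst integral_fst'[symmetric])
      (auto simp: inner_add_right cis_mult intro!: integrable_const_bound[where B=1])
  also have "\<dots> = char_fun \<mu> t * char_fun \<nu> t"
    unfolding char_fun_def by simp
  finally show ?thesis .
qed

text \<open>
  The kernel \<open>exp (- (norm (y - x))\<^sup>2 / (2 * s\<^sup>2))\<close> is the characteristic function of \<open>gaussian (1 / s)\<close> at \<open>x - y\<close>.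
  By Fubini, its integral in \<open>x\<close> depends on \<open>\<mu>\<close> only through \<open>char_fun \<mu>\<close>.
\<close>
lemma integral_gaussian_kernel_eq_char_fun:
  fixes \<mu> :: "'a::euclidean_space measure"
  assumes "\<mu> \<in> borel_probs" "s > 0"
  shows "(\<integral>\<^sup>+ x. ennreal (exp (- (norm (y - x))\<^sup>2 / (2 * s\<^sup>2))) \<partial>\<mu>)
    = ennreal (Re (\<integral>\<xi>. cis (- (y \<bullet> \<xi>)) * char_fun \<mu> \<xi> \<partial>gaussian (1 / s)))"
proof -
  note \<mu> = borel_probsD[OF assms(1)]
  note [measurable_cong] = \<mu>(2)
  let ?G = "gaussian (1 / s) :: 'a measure"
  let ?k = "\<lambda>x. exp (- (norm (y - x))\<^sup>2 / (2 * s\<^sup>2))"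
  interpret \<mu>: prob_space \<mu> by fact
  interpret G: prob_space ?G using assms(2) by (intro prob_space_gaussian) simp
  interpret pair_prob_space \<mu> ?G ..
  have k: "complex_of_real (?k x) = (\<integral>\<xi>. cis (- (y \<bullet> \<xi>)) * cis (\<xi> \<bullet> x) \<partial>?G)" for x
  proof -
    have "complex_of_real (?k x) = char_fun ?G (x - y)"
      using assms(2) by (subst char_fun_gaussian) (auto simp: norm_minus_commute power_divide)
    also have "\<dots> = (\<integral>\<xi>. cis (- (y \<bullet> \<xi>)) * cis (\<xi> \<bullet> x) \<partial>?G)"
      unfolding char_fun_def by (simp add: cis_mult inner_diff_left inner_commute[of x])
    finally show ?thesis .
  qed
  have "complex_of_real (\<integral>x. ?k x \<partial>\<mu>) = (\<integral>x. complex_of_real (?k x) \<partial>\<mu>)"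
    by simp
  also have "\<dots> = (\<integral>x. \<integral>\<xi>. cis (- (y \<bullet> \<xi>)) * cis (\<xi> \<bullet> x) \<partial>?G \<partial>\<mu>)"
    unfolding k ..
  also have "\<dots> = (\<integral>\<xi>. \<integral>x. cis (- (y \<bullet> \<xi>)) * cis (\<xi> \<bullet> x) \<partial>\<mu> \<partial>?G)"
    by (rule Fubini_integral[symmetric])
      (auto simp: case_prod_beta cis_mult intro!: integrable_const_bound[where B=1])
  also have "\<dots> = (\<integral>\<xi>. cis (- (y \<bullet> \<xi>)) * char_fun \<mu> \<xi> \<partial>?G)"
    unfolding char_fun_def by simp
  finally have "(\<integral>x. ?k x \<partial>\<mu>) = Re (\<integral>\<xi>. cis (- (y \<bullet> \<xi>)) * char_fun \<mu> \<xi> \<partial>?G)"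
    by (metis Re_complex_of_real)
  moreover have "(\<integral>\<^sup>+ x. ennreal (?k x) \<partial>\<mu>) = ennreal (\<integral>x. ?k x \<partial>\<mu>)"
    by (intro nn_integral_eq_integral \<mu>.integrable_const_bound[where B=1]) auto
  ultimately show ?thesis by simp
qed

lemma nn_integral_lborel_translate:
  fixes f :: "'a::euclidean_space \<Rightarrow> ennreal"
  assumes [measurable]: "f \<in> borel_measurable borel"
  shows "(\<integral>\<^sup>+ z. f (x + z) \<partial>lborel) = (\<integral>\<^sup>+ y. f y \<partial>lborel)"
  using nn_integral_distr[of "(+) x" lborel borel f] by (simp add: lborel_distr_plus)

lemma convolution_gaussian_eq_density:
  fixes \<mu> :: "'a::ordered_euclidean_space measure"
  assumes "\<mu> \<in> borel_probs" "s > 0"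
  shows "convolution \<mu> (gaussian s) = density lborel
    (\<lambda>y. (\<integral>\<^sup>+ x. ennreal (exp (- (norm (y - x))\<^sup>2 / (2 * s\<^sup>2))) \<partial>\<mu>)
      / ennreal (sqrt (2 * pi * s\<^sup>2) ^ DIM('a)))"
proof (rule measure_eqI)
  note \<mu> = borel_probsD[OF assms(1)]
  note [measurable_cong] = \<mu>(2)
  interpret \<mu>: prob_space \<mu> by fact
  interpret G: prob_space "gaussian s :: 'a measure" using assms(2) by (intro prob_space_gaussian) simp
  interpret pair_sigma_finite \<mu> "lborel :: 'a measure" ..
  define c where "c = sqrt (2 * pi * s\<^sup>2) ^ DIM('a)"
  have c: "c > 0" using assms(2) by (simp add: c_def)
  let ?k = "\<lambda>z::'a. ennreal (exp (- (norm z)\<^sup>2 / (2 * s\<^sup>2)))"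
  have G: "gaussian s = density lborel (\<lambda>z::'a. ?k z / ennreal c)"
    using assms(2) c by (simp add: gaussian_def c_def[symmetric] divide_ennreal)
  fix A assume "A \<in> sets (convolution \<mu> (gaussian s))"
  then have [measurable]: "A \<in> sets borel" by simp
  have "emeasure (convolution \<mu> (gaussian s)) A
    = (\<integral>\<^sup>+ x. \<integral>\<^sup>+ z. indicator A (x + z) \<partial>gaussian s \<partial>\<mu>)"
    by (rule convolution_emeasure') (auto simp: \<mu>(2) \<mu>.finite_measure_axioms G.finite_measure_axioms)
  also have "\<dots> = (\<integral>\<^sup>+ x. \<integral>\<^sup>+ y. ?k (y - x) / ennreal c * indicator A y \<partial>lborel \<partial>\<mu>)"
  proof (rule nn_integral_cong)
    fix x
    have "(\<integral>\<^sup>+ z. indicator A (x + z) \<partial>gaussian s)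
      = (\<integral>\<^sup>+ z. ?k z / ennreal c * indicator A (x + z) \<partial>lborel)"
      unfolding G by (subst nn_integral_density) auto
    also have "\<dots> = (\<integral>\<^sup>+ z. ?k ((x + z) - x) / ennreal c * indicator A (x + z) \<partial>lborel)"
      by simp
    also have "\<dots> = (\<integral>\<^sup>+ y. ?k (y - x) / ennreal c * indicator A y \<partial>lborel)"
      by (rule nn_integral_lborel_translate) measurable
    finally show "(\<integral>\<^sup>+ z. indicator A (x + z) \<partial>gaussian s)
      = (\<integral>\<^sup>+ y. ?k (y - x) / ennreal c * indicator A y \<partial>lborel)" .
  qed
  also have "\<dots> = (\<integral>\<^sup>+ y. \<integral>\<^sup>+ x. ?k (y - x) / ennreal c * indicator A y \<partial>\<mu> \<partial>lborel)"
    by (rule Fubini'[symmetric]) measurable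
  also have "\<dots> = (\<integral>\<^sup>+ y. (\<integral>\<^sup>+ x. ?k (y - x) \<partial>\<mu>) / ennreal c * indicator A y \<partial>lborel)"
    by (simp add: nn_integral_multc nn_integral_divide)
  also have "\<dots> = emeasure (density lborel (\<lambda>y. (\<integral>\<^sup>+ x. ?k (y - x) \<partial>\<mu>) / ennreal c)) A"
    by (subst emeasure_density) auto
  finally show "emeasure (convolution \<mu> (gaussian s)) A = emeasure (density lborel
    (\<lambda>y. (\<integral>\<^sup>+ x. ?k (y - x) \<partial>\<mu>) / ennreal (sqrt (2 * pi * s\<^sup>2) ^ DIM('a)))) A"
    by (simp add: c_def)
qed simp

section \<open>Gaussian smoothing\<close>

lemma P1_subset_borel_probs: "\<mu> \<in> P1 \<Longrightarrow> \<mu> \<in> borel_probs"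
  by (simp add: P1_def)

lemma gaussian_in_P1:
  assumes "\<sigma> \<ge> 0"
  shows "gaussian \<sigma> \<in> P1"
  using prob_space_gaussian[OF assms] le_less_trans[OF nn_integral_norm_gaussian_le[OF assms] ennreal_less_top]
  by (simp add: P1_def borel_probs_def)

lemma convolution_in_P1:
  fixes \<mu> \<nu> :: "'a::ordered_euclidean_space measure"
  assumes "\<mu> \<in> P1" "\<nu> \<in> P1"
  shows "convolution \<mu> \<nu> \<in> P1"
proof -
  have \<mu>: "prob_space \<mu>" "sets \<mu> = sets borel" "(\<integral>\<^sup>+ x. ennreal (norm x) \<partial>\<mu>) < \<infinity>"
   and \<nu>: "prob_space \<nu>" "sets \<nu> = sets borel" "(\<integral>\<^sup>+ x. ennreal (norm x) \<partial>\<nu>) < \<infinity>"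
    using assms by (auto simp: P1_def borel_probs_def)
  note [measurable_cong] = \<mu>(2) \<nu>(2)
  interpret \<mu>: prob_space \<mu> by fact
  interpret \<nu>: prob_space \<nu> by fact
  interpret pair_prob_space \<mu> \<nu> ..
  have "prob_space (convolution \<mu> \<nu>)"
    unfolding convolution_def by (intro prob_space_distr) measurable
  moreover have "(\<integral>\<^sup>+ x. ennreal (norm x) \<partial>convolution \<mu> \<nu>) < \<infinity>"
  proof -
    have "(\<integral>\<^sup>+ x. ennreal (norm x) \<partial>convolution \<mu> \<nu>) = (\<integral>\<^sup>+ x. \<integral>\<^sup>+ y. ennreal (norm (x + y)) \<partial>\<nu> \<partial>\<mu>)"
      by (rule nn_integral_convolution)
        (auto simp: \<mu>(2) \<nu>(2) \<mu>.finite_measure_axioms \<nu>.finite_measure_axioms)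
    also have "\<dots> \<le> (\<integral>\<^sup>+ x. \<integral>\<^sup>+ y. ennreal (norm x) + ennreal (norm y) \<partial>\<nu> \<partial>\<mu>)"
      by (intro nn_integral_mono)
        (simp add: ennreal_plus[symmetric] norm_triangle_ineq ennreal_leI del: ennreal_plus)
    also have "\<dots> = (\<integral>\<^sup>+ x. ennreal (norm x) \<partial>\<mu>) + (\<integral>\<^sup>+ y. ennreal (norm y) \<partial>\<nu>)"
      by (simp add: nn_integral_add \<mu>.emeasure_space_1 \<nu>.emeasure_space_1)
    also have "\<dots> < \<infinity>" using \<mu>(3) \<nu>(3) by simp
    finally show ?thesis .
  qed
  ultimately show ?thesis by (simp add: P1_def borel_probs_def)
qed

text \<open>
  Move each point \<open>x\<close> to \<open>x + z\<close> with independent noise \<open>z\<close> of law \<open>\<nu>\<close>; the distance travelled is \<open>norm z\<close>.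
\<close>
lemma W1_convolution_le:
  fixes \<mu> \<nu> :: "'a::ordered_euclidean_space measure"
  assumes "\<mu> \<in> borel_probs" "\<nu> \<in> borel_probs"
  shows "W1 \<mu> (convolution \<mu> \<nu>) \<le> (\<integral>\<^sup>+ x. ennreal (norm x) \<partial>\<nu>)"
proof -
  note \<mu> = borel_probsD[OF assms(1)] and \<nu> = borel_probsD[OF assms(2)]
  note [measurable_cong] = \<mu>(2) \<nu>(2)
  interpret \<mu>: prob_space \<mu> by fact
  interpret \<nu>: prob_space \<nu> by fact
  interpret pair_prob_space \<mu> \<nu> ..
  have "W1 \<mu> (convolution \<mu> \<nu>) \<le> (\<integral>\<^sup>+ z. ennreal (norm (fst z - (fst z + snd z))) \<partial>(\<mu> \<Otimes>\<^sub>M \<nu>))"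
    using W1_distr_le[OF prob_space_axioms, of fst "\<lambda>z. fst z + snd z"]
    by (simp add: convolution_def case_prod_unfold distr_fst_pair_measure \<mu>(2) \<nu>(1))
  also have "\<dots> = (\<integral>\<^sup>+ x. ennreal (norm x) \<partial>distr (\<mu> \<Otimes>\<^sub>M \<nu>) borel snd)"
    by (subst nn_integral_distr) auto
  also have "\<dots> = (\<integral>\<^sup>+ x. ennreal (norm x) \<partial>\<nu>)"
    by (simp add: distr_snd_pair_measure \<mu> \<nu>)
  finally show ?thesis .
qed

text \<open>
  Equal characteristic functions give equal Gaussian smoothings at every scale \<open>s > 0\<close>. Smoothing
  moves each measure by at most a multiple of \<open>s\<close> in \<open>W1\<close>, so the two measures are at \<open>W1\<close>-distance zero.
\<close>
lemma char_fun_eq_imp_eq: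
  fixes \<mu> \<nu> :: "'a::ordered_euclidean_space measure"
  assumes "\<mu> \<in> borel_probs" "\<nu> \<in> borel_probs" "char_fun \<mu> = char_fun \<nu>"
  shows "\<mu> = \<nu>"
proof (rule W1_eq_0_imp_eq)
  define C where "C = DIM('a) * sqrt (2 / pi)"
  have C: "C > 0" by (simp add: C_def)
  have "W1 \<mu> \<nu> \<le> 0"
  proof (rule ennreal_le_epsilon)
    fix e :: real assume e: "e > 0"
    define s where "s = e / (2 * C)"
    have s: "s > 0" using e C by (simp add: s_def)
    have G: "gaussian s \<in> (borel_probs :: 'a measure set)"
      using s by (simp add: borel_probs_def prob_space_gaussian)
    have eq: "convolution \<mu> (gaussian s) = convolution \<nu> (gaussian s)"
      unfolding convolution_gaussian_eq_density[OF assms(1) s] convolution_gaussian_eq_density[OF assms(2) s]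
        integral_gaussian_kernel_eq_char_fun[OF assms(1) s] integral_gaussian_kernel_eq_char_fun[OF assms(2) s]
        assms(3) ..
    have near: "W1 \<rho> (convolution \<rho> (gaussian s)) \<le> ennreal (e / 2)" if "\<rho> \<in> borel_probs" for \<rho> :: "'a measure"
    proof -
      have "W1 \<rho> (convolution \<rho> (gaussian s)) \<le> ennreal (C * s)"
        using order_trans[OF W1_convolution_le[OF that G] nn_integral_norm_gaussian_le] s
        by (simp add: C_def)
      then show ?thesis using C by (simp add: s_def)
    qed
    have "W1 \<mu> \<nu> \<le> W1 \<mu> (convolution \<mu> (gaussian s)) + W1 (convolution \<mu> (gaussian s)) \<nu>"
      by (rule W1_triangle)
    also have "\<dots> = W1 \<mu> (convolution \<mu> (gaussian s)) + W1 \<nu> (convolution \<nu> (gaussian s))"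
      unfolding eq by (simp add: W1_commute)
    also have "\<dots> \<le> ennreal (e / 2) + ennreal (e / 2)"
      by (intro add_mono near assms)
    also have "\<dots> = 0 + ennreal e"
      using e by (simp add: ennreal_plus[symmetric] del: ennreal_plus)
    finally show "W1 \<mu> \<nu> \<le> 0 + ennreal e" .
  qed
  then show "W1 \<mu> \<nu> = 0" by simp
qed fact+

text \<open>
  Convolution multiplies characteristic functions, and that of the Gaussian can be cancelled because it never vanishes.
\<close>
lemma convolution_gaussian_inj:
  fixes \<mu> \<nu> :: "'a::ordered_euclidean_space measure"
  assumes "\<mu> \<in> borel_probs" "\<nu> \<in> borel_probs" "\<sigma> \<ge> 0"
    and "convolution \<mu> (gaussian \<sigma>) = convolution \<nu> (gaussian \<sigma>)"
  shows "\<mu> = \<nu>"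
proof (rule char_fun_eq_imp_eq[OF assms(1,2)], rule ext)
  fix t
  have G: "gaussian \<sigma> \<in> (borel_probs :: 'a measure set)"
    using gaussian_in_P1[OF assms(3)] by (rule P1_subset_borel_probs)
  have "char_fun \<mu> t * char_fun (gaussian \<sigma>) t = char_fun \<nu> t * char_fun (gaussian \<sigma>) t"
    using assms(4) by (metis char_fun_convolution assms(1,2) G)
  moreover have "char_fun (gaussian \<sigma>) t \<noteq> 0"
    by (simp add: char_fun_gaussian[OF assms(3)])
  ultimately show "char_fun \<mu> t = char_fun \<nu> t" by simp
qed

theorem theorem1:
  fixes \<sigma> :: real
  assumes "\<sigma> \<ge> 0"
  shows "(\<forall>\<mu>\<in>P1. \<forall>\<nu>\<in>P1. W1_smooth \<sigma> \<mu> (\<nu> :: (real ^ 'n) measure) < \<infinity>) \<and>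
    Metric_space (P1 :: (real ^ 'n) measure set) (\<lambda>\<mu> \<nu>. enn2real (W1_smooth \<sigma> \<mu> \<nu>))"
proof -
  have smooth_P1: "convolution \<mu> (gaussian \<sigma>) \<in> P1" if "\<mu> \<in> P1" for \<mu> :: "(real ^ 'n) measure"
    using that assms by (intro convolution_in_P1 gaussian_in_P1)
  have finite: "W1_smooth \<sigma> \<mu> \<nu> < \<infinity>" if "\<mu> \<in> P1" "\<nu> \<in> P1" for \<mu> \<nu> :: "(real ^ 'n) measure"
    unfolding W1_smooth_def using that by (intro W1_finite smooth_P1)
  have "Metric_space (P1 :: (real ^ 'n) measure set) (\<lambda>\<mu> \<nu>. enn2real (W1_smooth \<sigma> \<mu> \<nu>))"
  proof
    fix \<mu> \<nu> \<rho> :: "(real ^ 'n) measure"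
    show "0 \<le> enn2real (W1_smooth \<sigma> \<mu> \<nu>)" by simp
    show "enn2real (W1_smooth \<sigma> \<mu> \<nu>) = enn2real (W1_smooth \<sigma> \<nu> \<mu>)"
      unfolding W1_smooth_def by (subst W1_commute) (rule refl)
    assume \<mu>: "\<mu> \<in> P1" and \<nu>: "\<nu> \<in> P1"
    note probs = P1_subset_borel_probs[OF \<mu>] P1_subset_borel_probs[OF \<nu>]
      P1_subset_borel_probs[OF smooth_P1[OF \<mu>]] P1_subset_borel_probs[OF smooth_P1[OF \<nu>]]
    show "enn2real (W1_smooth \<sigma> \<mu> \<nu>) = 0 \<longleftrightarrow> \<mu> = \<nu>"
    proof
      assume "enn2real (W1_smooth \<sigma> \<mu> \<nu>) = 0"
      then have "W1_smooth \<sigma> \<mu> \<nu> = 0"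
        using finite[OF \<mu> \<nu>] by (auto simp: enn2real_eq_0_iff)
      then have "convolution \<mu> (gaussian \<sigma>) = convolution \<nu> (gaussian \<sigma>)"
        unfolding W1_smooth_def by (rule W1_eq_0_imp_eq[OF probs(3,4)])
      then show "\<mu> = \<nu>" by (rule convolution_gaussian_inj[OF probs(1,2) assms])
    next
      assume "\<mu> = \<nu>"
      then show "enn2real (W1_smooth \<sigma> \<mu> \<nu>) = 0"
        unfolding W1_smooth_def using W1_self[OF probs(3)] by simp
    qed
    assume \<rho>: "\<rho> \<in> P1"
    have "W1_smooth \<sigma> \<mu> \<rho> \<le> W1_smooth \<sigma> \<mu> \<nu> + W1_smooth \<sigma> \<nu> \<rho>"
      unfolding W1_smooth_def by (rule W1_triangle)
    then show "enn2real (W1_smooth \<sigma> \<mu> \<rho>)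
        \<le> enn2real (W1_smooth \<sigma> \<mu> \<nu>) + enn2real (W1_smooth \<sigma> \<nu> \<rho>)"
      using finite[OF \<mu> \<nu>] finite[OF \<nu> \<rho>]
      by (subst enn2real_plus[symmetric]) (auto intro!: enn2real_mono)
  qed
  then show ?thesis using finite by blast
qed

end
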